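(* Let $k,s,t$ be integers with $k\geq 3$ and $t\geq s\geq 1$, and let $\beta$ be a positive real number. There is an integer $N=N(s,t,\beta)$ such that if $n\geq N$, then every $(s,t)$-union intersecting family $\mathcal{A}\subseteq {[n]\choose k}$ with $|\mathcal{A}|\geq (s+\beta)M$ satisfies $\ell(\mathcal{A})\leq s-1$, where $M={n-1\choose k-1}-{n-k-1\choose k-1}$.
   Context: ${[n]\choose k}$ denotes the family of all $k$-subsets of $[n]=\{1,\ldots,n\}$. A family is intersecting if every two of its members have nonempty intersection. For $\mathcal{A}\subseteq{[n]\choose k}$, let $\mathcal{A}^*$ be a largest intersecting subfamily of $\mathcal{A}$ and $\ell(\mathcal{A})=|\mathcal{A}\setminus\mathcal{A}^*|$ (this does not depend on the choice of $\mathcal{A}^*$). For positive integers $t\geq s$, a family $\mathcal{A}\subseteq{[n]\choose k}$ is $(s,t)$-union intersecting if for every $s$-element subfamily $\{A_1,\ldots,A_s\}\subseteq\mathcal{A}$ and every $t$-element subfamily $\{B_1,\ldots,B_t\}\subseteq\mathcal{A}$ we have $\left(\bigcup_{i=1}^s A_i\right)\cap\left(\bigcup_{i=1}^t B_i\right)\neq\varnothing$.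
   Formalization: N may depend on k as well as on s, t, β; with N independent of k the claim fails: for s=1, t=2, β=1/2, n=2k, the family of all k-subsets of [2k] meets every hypothesis but has ℓ>0. *)

theory Defs
  imports Complex_Main "HOL-Library.Ramsey"
begin

definition intersecting :: "'a set set \<Rightarrow> bool" where
  "intersecting F \<longleftrightarrow> pairwise (\<lambda>A B. A \<inter> B \<noteq> {}) F"

(* Meant for finite families, where card is the number of members. *)
definition largest_intersecting_subfamily :: "'a set set \<Rightarrow> 'a set set \<Rightarrow> bool" where
  "largest_intersecting_subfamily F G \<longleftrightarrow>
     G \<subseteq> F \<and> intersecting G \<and> (\<forall>H. H \<subseteq> F \<and> intersecting H \<longrightarrow> card H \<le> card G)"

(* For finite F the chosen G exists and its choice does not matter: see the lemmas below. *)
definition ell :: "'a set set \<Rightarrow> nat" where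
  "ell F = card (F - (SOME G. largest_intersecting_subfamily F G))"

(* The two subfamilies S and T may overlap. *)
definition union_intersecting :: "nat \<Rightarrow> nat \<Rightarrow> 'a set set \<Rightarrow> bool" where
  "union_intersecting s t F \<longleftrightarrow>
     (\<forall>S T. S \<subseteq> F \<and> finite S \<and> card S = s \<and> T \<subseteq> F \<and> finite T \<and> card T = t
        \<longrightarrow> \<Union>S \<inter> \<Union>T \<noteq> {})"

lemma largest_intersecting_subfamily_exists:
  assumes "finite F"
  shows "\<exists>G. largest_intersecting_subfamily F G"
proof -
  let ?P = "\<lambda>G. G \<subseteq> F \<and> intersecting G"
  have "?P {}" by (simp add: intersecting_def)
  moreover have "\<forall>G. ?P G \<longrightarrow> card G < Suc (card F)"
    using assms by (simp add: card_mono less_Suc_eq_le)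
  ultimately obtain G where "?P G" "\<forall>H. ?P H \<longrightarrow> card H \<le> card G"
    using ex_has_greatest_nat[of ?P "{}" card "Suc (card F)"] by blast
  then show ?thesis unfolding largest_intersecting_subfamily_def by blast
qed

lemma ell_eq:
  assumes "finite F" "largest_intersecting_subfamily F G"
  shows "ell F = card (F - G)"
proof -
  define G' where "G' = (SOME G. largest_intersecting_subfamily F G)"
  have G': "largest_intersecting_subfamily F G'"
    unfolding G'_def using assms(2) by (rule someI)
  then have "card G' = card G"
    using assms(2) unfolding largest_intersecting_subfamily_def by (meson le_antisym)
  moreover have "G' \<subseteq> F" "G \<subseteq> F"
    using G' assms(2) unfolding largest_intersecting_subfamily_def by auto
  ultimately show ?thesis
    unfolding ell_def G'_def[symmetric]
    using assms(1) by (metis card_Diff_subset finite_subset)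
qed

end

theory Submission
  imports Defs
begin

text \<open>
  Suppose that \<open>\<ell>(F) \<ge> s\<close>. Then every point \<open>x\<close> is avoided by at least \<open>s\<close> members of \<open>F\<close>.
  The union of any \<open>s\<close> members of \<open>F\<close> meets all but fewer than \<open>t\<close> members. Applied to \<open>s\<close> members
  avoiding \<open>x\<close>, this gives \<open>|F\<^sub>x| \<le> s M + t\<close> for the star at \<open>x\<close>. Applied first to arbitrary \<open>s\<close>
  members with union \<open>U\<close>, and then for each \<open>x \<in> U\<close> to \<open>s\<close> members avoiding \<open>x\<close>, it yields a
  bounded number of pairs such that all but boundedly many members of \<open>F\<close> contain one of them.
  Discard the pairs of degree \<open>O(c)\<close>, where \<open>c = C(n-3, k-3)\<close>. Two disjoint pairs of larger
  degree would produce a forbidden configuration, so the remaining pairs form a star or a triangle.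
  In the star case only \<open>O(c)\<close> members avoid its centre, hence \<open>|F| \<le> s M + O(c)\<close>; in the triangle
  case \<open>|F| \<le> 3 C(n-2, k-2) + O(c) \<le> M + O(c)\<close>. Both contradict \<open>|F| \<ge> (s + \<beta>) M\<close> for large \<open>n\<close>,
  since \<open>M \<ge> C(n-2, k-2) = (n-2)/(k-2) c\<close>.
\<close>

section \<open>Counting \<open>k\<close>-sets through prescribed points\<close>

lemma card_nsets_superset:
  assumes "finite V" "P \<subseteq> V" "card P \<le> k"
  shows "card {A \<in> nsets V k. P \<subseteq> A} = (card V - card P) choose (k - card P)"
proof -
  have finP: "finite P" using assms finite_subset by blast
  have "bij_betw (\<lambda>B. B \<union> P) (nsets (V - P) (k - card P)) {A \<in> nsets V k. P \<subseteq> A}"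
  proof (rule bij_betw_byWitness[where f' = "\<lambda>A. A - P"])
    show "(\<lambda>B. B \<union> P) ` nsets (V - P) (k - card P) \<subseteq> {A \<in> nsets V k. P \<subseteq> A}"
    proof clarsimp
      fix B assume B: "B \<in> nsets (V - P) (k - card P)"
      then have "B \<inter> P = {}" "finite B" "card B = k - card P" by (auto simp: nsets_def)
      then have "card (B \<union> P) = k" using finP assms(3) by (simp add: card_Un_disjoint)
      then show "B \<union> P \<in> nsets V k" using B assms finP by (auto simp: nsets_def)
    qed
    show "(\<lambda>A. A - P) ` {A \<in> nsets V k. P \<subseteq> A} \<subseteq> nsets (V - P) (k - card P)"
      using finP by (auto simp: nsets_def card_Diff_subset)
  qed (auto simp: nsets_def)
  from bij_betw_same_card[OF this, symmetric] show ?thesis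
    using assms finP by (simp add: card_Diff_subset)
qed

text \<open>Remove from the full star at \<open>x\<close> the star at \<open>x\<close> inside
  \<open>V - B\<close>; as \<open>x\<close> lies outside \<open>B\<close>, both are counted by
  \<open>card_nsets_superset\<close>. This is how \<open>M\<close> enters the argument.\<close>

lemma card_star_meeting:
  assumes "finite V" "x \<in> V" "B \<in> nsets V k" "x \<notin> B" "k \<ge> 1"
  shows "card {A \<in> nsets V k. x \<in> A \<and> A \<inter> B \<noteq> {}}
    = ((card V - 1) choose (k - 1)) - ((card V - k - 1) choose (k - 1))"
proof -
  have B: "B \<subseteq> V" "finite B" "card B = k" using assms by (auto simp: nsets_def)
  have "{A \<in> nsets V k. x \<in> A \<and> A \<inter> B \<noteq> {}}
      = {A \<in> nsets V k. {x} \<subseteq> A} - {A \<in> nsets (V - B) k. {x} \<subseteq> A}"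
    by (auto simp: nsets_def)
  moreover have "card ({A \<in> nsets V k. {x} \<subseteq> A} - {A \<in> nsets (V - B) k. {x} \<subseteq> A})
      = card {A \<in> nsets V k. {x} \<subseteq> A} - card {A \<in> nsets (V - B) k. {x} \<subseteq> A}"
    using assms(1) by (intro card_Diff_subset) (auto simp: nsets_def)
  moreover have "card {A \<in> nsets V k. {x} \<subseteq> A} = (card V - 1) choose (k - 1)"
    using card_nsets_superset[of V "{x}" k] assms by simp
  moreover have "card {A \<in> nsets (V - B) k. {x} \<subseteq> A} = (card V - k - 1) choose (k - 1)"
    using card_nsets_superset[of "V - B" "{x}" k] assms B by (simp add: card_Diff_subset)
  ultimately show ?thesis by simp
qed

lemma card_UN_le_mult:
  assumes "finite I" "\<And>i. i \<in> I \<Longrightarrow> card (f i) \<le> d"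
  shows "card (\<Union>i\<in>I. f i) \<le> card I * d"
proof -
  have "card (\<Union>i\<in>I. f i) \<le> (\<Sum>i\<in>I. card (f i))" using assms(1) by (rule card_UN_le)
  also have "\<dots> \<le> card I * d" using assms(2) sum_bounded_above[of I "\<lambda>i. card (f i)" d] by simp
  finally show ?thesis .
qed

text \<open>Union bound over the point of \<open>W\<close> that is hit. For a pair \<open>P\<close>
  and a bounded \<open>W\<close> it says that only O(C(n-3, k-3)) of the \<open>k\<close>-sets
  through \<open>P\<close> meet \<open>W\<close>.\<close>

lemma card_superset_meeting_le:
  assumes "finite V" "P \<subseteq> V" "W \<subseteq> V" "P \<inter> W = {}" "card P < k"
  shows "card {A \<in> nsets V k. P \<subseteq> A \<and> A \<inter> W \<noteq> {}}
    \<le> card W * ((card V - Suc (card P)) choose (k - Suc (card P)))"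
proof -
  have fin: "finite P" "finite W" using assms finite_subset by blast+
  have "{A \<in> nsets V k. P \<subseteq> A \<and> A \<inter> W \<noteq> {}} = (\<Union>w\<in>W. {A \<in> nsets V k. insert w P \<subseteq> A})"
    by auto
  also have "card \<dots> \<le> card W * ((card V - Suc (card P)) choose (k - Suc (card P)))"
  proof (rule card_UN_le_mult[OF fin(2)])
    fix w assume "w \<in> W"
    then have "w \<notin> P" "w \<in> V" using assms by auto
    then show "card {A \<in> nsets V k. insert w P \<subseteq> A}
        \<le> (card V - Suc (card P)) choose (k - Suc (card P))"
      using card_nsets_superset[of V "insert w P" k] assms fin by simp
  qed
  finally show ?thesis .
qed

section \<open>Pairwise intersecting pairs\<close>

text \<open>Given a pair \<open>{a, b}\<close>, one missing \<open>a\<close> and one missing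
  \<open>b\<close> must be \<open>{b, c}\<close> and \<open>{a, c}\<close> with the same
  \<open>c\<close>; a pair that meets all three sides of this triangle is itself a side.\<close>

lemma intersecting_pairs_star_or_triangle:
  assumes "finite Q" and two: "\<And>P. P \<in> Q \<Longrightarrow> card P = 2"
    and int: "\<And>P P'. P \<in> Q \<Longrightarrow> P' \<in> Q \<Longrightarrow> P \<inter> P' \<noteq> {}"
    and nostar: "\<not> (\<exists>x\<in>V. \<forall>P\<in>Q. x \<in> P)" and "V \<noteq> {}" "\<Union>Q \<subseteq> V"
  shows "card Q \<le> 3"
proof -
  \<comment> \<open>\<open>Q\<close> is nonempty: otherwise any point of \<open>V\<close> would
    vacuously be a common point.\<close>
  obtain P where P: "P \<in> Q" using nostar \<open>V \<noteq> {}\<close> by blast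
  then obtain a b where ab: "P = {a, b}" "a \<noteq> b" using two card_2_iff by metis
  then have V: "a \<in> V" "b \<in> V" using P assms(6) by auto
  obtain P1 where P1: "P1 \<in> Q" "a \<notin> P1" using nostar V by blast
  obtain P2 where P2: "P2 \<in> Q" "b \<notin> P2" using nostar V by blast
  have "b \<in> P1" using int[OF P P1(1)] P1 ab by auto
  then obtain c where c: "P1 = {b, c}" "b \<noteq> c"
    using two[OF P1(1)] by (auto simp: card_2_iff)
  have "a \<in> P2" using int[OF P P2(1)] P2 ab by auto
  then obtain d where d: "P2 = {a, d}" "a \<noteq> d"
    using two[OF P2(1)] by (auto simp: card_2_iff)
  have "c = d" using int[OF P1(1) P2(1)] P1 P2 c d ab by auto
  have "Q \<subseteq> {{a, b}, {b, c}, {a, c}}"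
  proof
    fix R assume R: "R \<in> Q"
    then obtain u v where uv: "R = {u, v}" "u \<noteq> v" using two card_2_iff by metis
    show "R \<in> {{a, b}, {b, c}, {a, c}}"
      using int[OF R P] int[OF R P1(1)] int[OF R P2(1)] uv ab c d \<open>c = d\<close> P1 by auto
  qed
  then have "card Q \<le> card {{a, b}, {b, c}, {a, c}}" by (simp add: card_mono)
  also have "\<dots> \<le> 3" by (auto simp: card_insert_if)
  finally show ?thesis .
qed

section \<open>Consequences of the union-intersecting property\<close>

lemma union_intersecting_few_avoid:
  assumes "union_intersecting s t F" "S \<subseteq> F" "finite S" "card S = s"
  shows "card {A \<in> F. A \<inter> \<Union>S = {}} \<le> t"
proof (rule ccontr)
  assume "\<not> ?thesis"
  then obtain T where T: "T \<subseteq> {A \<in> F. A \<inter> \<Union>S = {}}" "card T = t" "finite T"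
    by (meson nat_le_linear obtain_subset_with_card_n)
  then have "\<Union>S \<inter> \<Union>T \<noteq> {}" using assms unfolding union_intersecting_def by blast
  then show False using T by blast
qed

text \<open>The star at \<open>x\<close> is intersecting, hence no larger than a largest
  intersecting subfamily; compare complements. So \<open>s \<le> ell F\<close> supplies
  \<open>s\<close> members avoiding any given point.\<close>

lemma ell_le_card_avoid:
  assumes "finite F"
  shows "ell F \<le> card {A \<in> F. x \<notin> A}"
proof -
  obtain G where G: "largest_intersecting_subfamily F G"
    using largest_intersecting_subfamily_exists[OF assms] by blast
  have "intersecting {A \<in> F. x \<in> A}" by (auto simp: intersecting_def pairwise_def)
  then have le: "card {A \<in> F. x \<in> A} \<le> card G"
    using G by (simp add: largest_intersecting_subfamily_def)
  have GF: "G \<subseteq> F" using G by (simp add: largest_intersecting_subfamily_def)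
  have "F - {A \<in> F. x \<in> A} = {A \<in> F. x \<notin> A}" by auto
  then have "card {A \<in> F. x \<notin> A} = card F - card {A \<in> F. x \<in> A}"
    using card_Diff_subset[of "{A \<in> F. x \<in> A}" F] assms by simp
  moreover have "ell F = card F - card G"
    using ell_eq[OF assms G] GF assms by (metis card_Diff_subset finite_subset)
  ultimately show ?thesis using le by simp
qed

lemma card_Union_nsets_le:
  assumes "S \<subseteq> nsets V k" "finite S" "card S = s"
  shows "card (\<Union>S) \<le> s * k"
  using card_UN_le_mult[OF assms(2), of "\<lambda>A. A" k] assms by (auto simp: nsets_def)

text \<open>Fix \<open>s\<close> members avoiding \<open>x\<close>. Each is met by at most
  \<open>M\<close> of the \<open>k\<close>-sets through \<open>x\<close>, and at most
  \<open>t\<close> members of \<open>F\<close> miss all of them.\<close>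

lemma card_star_le:
  assumes V: "finite V" and F: "F \<subseteq> nsets V k" and ui: "union_intersecting s t F"
    and "x \<in> V" "k \<ge> 1" and s: "s \<le> card {A \<in> F. x \<notin> A}"
  shows "card {A \<in> F. x \<in> A}
    \<le> s * (((card V - 1) choose (k - 1)) - ((card V - k - 1) choose (k - 1))) + t"
proof -
  obtain S where S: "S \<subseteq> {A \<in> F. x \<notin> A}" "card S = s" "finite S"
    using s by (meson obtain_subset_with_card_n)
  let ?X = "\<Union>B\<in>S. {A \<in> nsets V k. x \<in> A \<and> A \<inter> B \<noteq> {}}"
  let ?Y = "{A \<in> F. A \<inter> \<Union>S = {}}"
  have finV: "finite (nsets V k)" using V by (simp add: finite_imp_finite_nsets)
  then have fin: "finite ?X" "finite ?Y" using S F finite_subset by (auto intro: finite_subset)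
  have "card ?X \<le> card S * (((card V - 1) choose (k - 1)) - ((card V - k - 1) choose (k - 1)))"
  proof (rule card_UN_le_mult[OF S(3)])
    fix B assume "B \<in> S"
    then have "B \<in> nsets V k" "x \<notin> B" using S F by auto
    then show "card {A \<in> nsets V k. x \<in> A \<and> A \<inter> B \<noteq> {}}
        \<le> ((card V - 1) choose (k - 1)) - ((card V - k - 1) choose (k - 1))"
      using card_star_meeting[OF V \<open>x \<in> V\<close> _ _ \<open>k \<ge> 1\<close>] by simp
  qed
  moreover have "card ?Y \<le> t" using union_intersecting_few_avoid[OF ui] S by blast
  moreover have "{A \<in> F. x \<in> A} \<subseteq> ?X \<union> ?Y" using F by auto
  then have "card {A \<in> F. x \<in> A} \<le> card ?X + card ?Y"
    using fin by (meson card_Un_le card_mono finite_UnI le_trans)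
  ultimately show ?thesis unfolding S(2) by linarith
qed

text \<open>If the pairs were disjoint, one could choose \<open>s\<close> members through
  \<open>P\<close> avoiding \<open>P'\<close>, then \<open>t\<close> members through
  \<open>P'\<close> avoiding the union of the first ones. The factors \<open>2\<close> and
  \<open>s * k\<close> bound the sizes of the two sets to be avoided.\<close>

lemma high_degree_pairs_meet:
  assumes V: "finite V" and F: "F \<subseteq> nsets V k" and ui: "union_intersecting s t F"
    and k: "k \<ge> 3" and P: "P \<subseteq> V" "card P = 2" and P': "P' \<subseteq> V" "card P' = 2"
    and d: "card {A \<in> F. P \<subseteq> A} \<ge> 2 * ((card V - 3) choose (k - 3)) + s"
    and d': "card {A \<in> F. P' \<subseteq> A} \<ge> s * k * ((card V - 3) choose (k - 3)) + t"
  shows "P \<inter> P' \<noteq> {}"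
proof
  assume disj: "P \<inter> P' = {}"
  let ?c = "(card V - 3) choose (k - 3)"
  have finF: "finite F" using V F finite_imp_finite_nsets finite_subset by blast
  \<comment> \<open>At most \<open>card W * ?c\<close> sets through \<open>P\<close> meet
    \<open>W\<close>, so a degree larger by \<open>m\<close> leaves \<open>m\<close> members to
    choose from.\<close>
  have pick: "\<exists>S. S \<subseteq> {A \<in> F. P \<subseteq> A \<and> A \<inter> W = {}} \<and> card S = m \<and> finite S"
    if "P \<subseteq> V" "card P = 2" "W \<subseteq> V" "P \<inter> W = {}" "card W * ?c + m \<le> card {A \<in> F. P \<subseteq> A}"
    for P W m
  proof -
    let ?B = "{A \<in> nsets V k. P \<subseteq> A \<and> A \<inter> W \<noteq> {}}"
    have finB: "finite ?B" using V by (simp add: finite_imp_finite_nsets)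
    have "card ?B \<le> card W * ?c"
      using card_superset_meeting_le[OF V that(1,3,4), of k] that(2) k by (simp add: eval_nat_numeral)
    moreover have "card {A \<in> F. P \<subseteq> A} \<le> card ?B + card {A \<in> F. P \<subseteq> A \<and> A \<inter> W = {}}"
      using finB finF F
      by (intro order.trans[OF card_mono card_Un_le]) auto
    ultimately have "m \<le> card {A \<in> F. P \<subseteq> A \<and> A \<inter> W = {}}" using that(5) by linarith
    then show ?thesis by (meson obtain_subset_with_card_n)
  qed
  obtain S where S: "S \<subseteq> {A \<in> F. P \<subseteq> A \<and> A \<inter> P' = {}}" "card S = s" "finite S"
    using pick[OF P P'(1) disj, of s] d P' by auto
  have "card (\<Union>S) \<le> s * k" using S F by (intro card_Union_nsets_le) auto
  then have "card (\<Union>S) * ?c + t \<le> card {A \<in> F. P' \<subseteq> A}"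
    using d' by (meson add_le_mono1 le_trans mult_le_mono1)
  moreover have "\<Union>S \<subseteq> V" using S F by (auto simp: nsets_def)
  \<comment> \<open>The second use of \<open>pick\<close> needs this disjointness, which is why
    \<open>S\<close> had to avoid \<open>P'\<close>.\<close>
  moreover have "P' \<inter> \<Union>S = {}" using S by auto
  ultimately obtain T where T: "T \<subseteq> {A \<in> F. P' \<subseteq> A \<and> A \<inter> \<Union>S = {}}" "card T = t" "finite T"
    using pick[OF P', of "\<Union>S" t] by blast
  have "S \<subseteq> F" "T \<subseteq> F" using S(1) T(1) by auto
  then have "\<Union>S \<inter> \<Union>T \<noteq> {}"
    using ui S(2,3) T(2,3) unfolding union_intersecting_def by simp
  moreover have "\<Union>S \<inter> \<Union>T = {}" using T(1) by blast
  ultimately show False by simp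
qed

text \<open>A typical member meets \<open>U\<close> in some \<open>x\<close>, and then meets the
  union of \<open>S x\<close>, which misses \<open>x\<close>, in a second point \<open>y\<close>.
  The exceptions number at most \<open>t\<close> for \<open>U\<close> and \<open>t\<close> for each
  of its at most \<open>s * k\<close> points.\<close>

lemma covering_pairs:
  assumes V: "finite V" and F: "F \<subseteq> nsets V k" and ui: "union_intersecting s t F"
    and avoid: "\<And>x. x \<in> V \<Longrightarrow> s \<le> card {A \<in> F. x \<notin> A}" and "V \<noteq> {}"
  obtains Q where "finite Q" "card Q \<le> (s * k) * (s * k)" "\<And>P. P \<in> Q \<Longrightarrow> P \<subseteq> V \<and> card P = 2"
    "card {A \<in> F. \<not> (\<exists>P\<in>Q. P \<subseteq> A)} \<le> t + s * k * t"
proof -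
  have finF: "finite F" using V F finite_imp_finite_nsets finite_subset by blast
  have "\<forall>x\<in>V. \<exists>S. S \<subseteq> {A \<in> F. x \<notin> A} \<and> card S = s \<and> finite S"
    using avoid by (meson obtain_subset_with_card_n)
  then obtain S where S: "\<And>x. x \<in> V \<Longrightarrow> S x \<subseteq> {A \<in> F. x \<notin> A} \<and> card (S x) = s \<and> finite (S x)"
    by metis
  obtain v where v: "v \<in> V" using \<open>V \<noteq> {}\<close> by blast
  define U where "U = \<Union>(S v)"
  have union: "card (\<Union>(S x)) \<le> s * k" "\<Union>(S x) \<subseteq> V" "x \<notin> \<Union>(S x)" "finite (\<Union>(S x))"
    if "x \<in> V" for x
    using S[OF that] F finite_subset[OF _ V]
    by (auto simp: nsets_def intro!: card_Union_nsets_le[where V = V])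
  have few: "card {A \<in> F. A \<inter> \<Union>(S x) = {}} \<le> t" if "x \<in> V" for x
    using S[OF that] union_intersecting_few_avoid[OF ui] by blast
  have U: "card U \<le> s * k" "U \<subseteq> V" "finite U" using union[OF v] unfolding U_def by auto
  define Q where "Q = (\<Union>x\<in>U. (\<lambda>y. {x, y}) ` \<Union>(S x))"
  have "card Q \<le> card U * (s * k)" unfolding Q_def
  proof (rule card_UN_le_mult[OF U(3)])
    fix x assume "x \<in> U"
    then have "x \<in> V" using U by auto
    show "card ((\<lambda>y. {x, y}) ` \<Union>(S x)) \<le> s * k"
      by (rule order.trans[OF card_image_le[OF union(4)] union(1)]) fact+
  qed
  then have "card Q \<le> (s * k) * (s * k)" using U by (meson le_trans mult_le_mono1)
  moreover have "finite Q" unfolding Q_def using U union by auto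
  moreover have "P \<subseteq> V \<and> card P = 2" if P: "P \<in> Q" for P
  proof -
    obtain x y where xy: "x \<in> U" "y \<in> \<Union>(S x)" "P = {x, y}" using P unfolding Q_def by blast
    then have "x \<in> V" using U by auto
    then have "y \<in> V" "x \<noteq> y" using xy union[of x] by auto
    then show ?thesis using xy \<open>x \<in> V\<close> by auto
  qed
  moreover have "card {A \<in> F. \<not> (\<exists>P\<in>Q. P \<subseteq> A)} \<le> t + s * k * t"
  proof -
    let ?X = "{A \<in> F. A \<inter> U = {}}" and ?Y = "\<Union>x\<in>U. {A \<in> F. A \<inter> \<Union>(S x) = {}}"
    have "{A \<in> F. \<not> (\<exists>P\<in>Q. P \<subseteq> A)} \<subseteq> ?X \<union> ?Y"
    proof
      fix A assume A: "A \<in> {A \<in> F. \<not> (\<exists>P\<in>Q. P \<subseteq> A)}"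
      show "A \<in> ?X \<union> ?Y"
      proof (rule ccontr)
        assume n: "A \<notin> ?X \<union> ?Y"
        then obtain x where x: "x \<in> A" "x \<in> U" using A by blast
        then obtain y where y: "y \<in> A" "y \<in> \<Union>(S x)" using n A by blast
        have "{x, y} \<in> Q" using x(2) y(2) unfolding Q_def by blast
        moreover have "{x, y} \<subseteq> A" using x(1) y(1) by simp
        ultimately show False using A by auto
      qed
    qed
    then have "card {A \<in> F. \<not> (\<exists>P\<in>Q. P \<subseteq> A)} \<le> card ?X + card ?Y"
      using finF U by (intro order.trans[OF card_mono card_Un_le]) auto
    moreover have "card ?X \<le> t" using few[OF v] unfolding U_def .
    moreover have "card ?Y \<le> card U * t" using few U by (intro card_UN_le_mult) auto
    moreover have "card U * t \<le> s * k * t" using U by simp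
    ultimately show ?thesis by linarith
  qed
  ultimately show ?thesis using that by blast
qed

section \<open>Binomial estimates for \<open>M\<close>\<close>

text \<open>The first bound lets a triangle of pairs cost only one \<open>M\<close>; the other two
  make C(n-3, k-3) negligible against \<open>M\<close>.\<close>

lemma hilton_milner_bounds:
  assumes k: "k \<ge> 3" and n: "n \<ge> k + 4"
  defines "M \<equiv> ((n - 1) choose (k - 1)) - ((n - k - 1) choose (k - 1))"
  shows "3 * ((n - 2) choose (k - 2)) \<le> M + 3 * ((n - 3) choose (k - 3))"
    and "(n - 2) choose (k - 2) \<le> M"
    and "(k - 2) * ((n - 2) choose (k - 2)) = (n - 2) * ((n - 3) choose (k - 3))"
proof -
  obtain j where j: "k = j + 3" using k by (metis add.commute le_Suc_ex)
  define m where "m = n - 4"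
  have nm: "n = m + 4" using n m_def by simp
  \<comment> \<open>Since \<open>k \<ge> 3\<close>, the subtracted term is at most the last term
    left after three uses of Pascal's rule.\<close>
  have "(n - k - 1) choose (k - 1) \<le> m choose (k - 1)"
    using nm k by (intro binomial_right_mono) simp
  moreover have "(n - 1) choose (k - 1)
      = ((m + 2) choose (k - 2)) + ((m + 1) choose (k - 2)) + (m choose (k - 2)) + (m choose (k - 1))"
    unfolding nm j by (simp add: numeral_eq_Suc)
  ultimately have M: "M \<ge> ((m + 2) choose (k - 2)) + ((m + 1) choose (k - 2)) + (m choose (k - 2))"
    unfolding M_def by linarith
  then show "(n - 2) choose (k - 2) \<le> M" unfolding nm by simp
  \<comment> \<open>Compared with C(n-2, k-2), the second summand loses one term of lower index
    \<open>k - 3\<close> and the third loses two, each at most C(n-3, k-3).\<close>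
  have "(m + 2) choose (k - 2) = ((m + 1) choose (k - 3)) + ((m + 1) choose (k - 2))"
    and "(m + 1) choose (k - 2) = (m choose (k - 3)) + (m choose (k - 2))"
    unfolding j by (simp_all add: numeral_eq_Suc)
  moreover have "m choose (k - 3) \<le> (m + 1) choose (k - 3)" by (intro binomial_right_mono) simp
  ultimately show "3 * ((n - 2) choose (k - 2)) \<le> M + 3 * ((n - 3) choose (k - 3))"
    using M unfolding nm by simp
  show "(k - 2) * ((n - 2) choose (k - 2)) = (n - 2) * ((n - 3) choose (k - 3))"
    using Suc_times_binomial_eq[of "m + 1" j] unfolding nm j by (simp add: numeral_eq_Suc mult.commute)
qed

section \<open>The size bound and the contradiction\<close>

lemma card_le_of_avoid:
  assumes k: "k \<ge> 3" and st: "t \<ge> s" and s: "s \<ge> 1" and n: "card V \<ge> k + 4" and V: "finite V"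
    and F: "F \<subseteq> nsets V k" and ui: "union_intersecting s t F"
    and avoid: "\<And>x. x \<in> V \<Longrightarrow> s \<le> card {A \<in> F. x \<notin> A}"
  shows "card F \<le> s * (((card V - 1) choose (k - 1)) - ((card V - k - 1) choose (k - 1)))
    + (2 * t + s * k * t + (s * k) * (s * k) * (s * k + 2 + t) + 3) * ((card V - 3) choose (k - 3))"
    (is "_ \<le> s * ?M + ?K * ?c")
proof -
  have finF: "finite F" using V F finite_imp_finite_nsets finite_subset by blast
  have c: "?c \<ge> 1" using n zero_less_binomial[of "k - 3" "card V - 3"] by linarith
  have "V \<noteq> {}" using n by auto
  obtain Q where Q: "finite Q" "card Q \<le> (s * k) * (s * k)" "\<And>P. P \<in> Q \<Longrightarrow> P \<subseteq> V \<and> card P = 2"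
    "card {A \<in> F. \<not> (\<exists>P\<in>Q. P \<subseteq> A)} \<le> t + s * k * t"
    using covering_pairs[OF V F ui avoid \<open>V \<noteq> {}\<close>] by blast
  \<comment> \<open>\<open>D\<close> dominates both thresholds of
    \<open>high_degree_pairs_meet\<close>, in either order of the two pairs;
    \<open>s \<le> t\<close> is used here.\<close>
  define D where "D = (s * k + 2) * ?c + t"
  define R where "R = {P \<in> Q. card {A \<in> F. P \<subseteq> A} \<ge> D}"
  let ?Bad = "{A \<in> F. \<not> (\<exists>P\<in>R. P \<subseteq> A)}"
  \<comment> \<open>Members containing no pair of \<open>Q\<close>, plus fewer than \<open>D\<close>
    for each discarded pair.\<close>
  define E where "E = t + s * k * t + (s * k) * (s * k) * D"
  have bad: "card ?Bad \<le> E"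
  proof -
    let ?X = "{A \<in> F. \<not> (\<exists>P\<in>Q. P \<subseteq> A)}" and ?Y = "\<Union>P\<in>Q - R. {A \<in> F. P \<subseteq> A}"
    have "card ?Bad \<le> card ?X + card ?Y"
      using finF Q(1) by (intro order.trans[OF card_mono card_Un_le]) auto
    moreover have "card ?Y \<le> card (Q - R) * D"
      using Q(1) by (intro card_UN_le_mult) (auto simp: R_def)
    moreover have "card (Q - R) \<le> (s * k) * (s * k)"
      using Q(1,2) by (meson Diff_subset card_mono le_trans)
    then have "card (Q - R) * D \<le> (s * k) * (s * k) * D" by (rule mult_le_mono1)
    ultimately show ?thesis using Q(4) unfolding E_def by linarith
  qed
  \<comment> \<open>The slack \<open>t\<close> serves the star case and \<open>3 * ?c\<close> the
    triangle case; \<open>?c \<ge> 1\<close> absorbs the constants.\<close>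
  have EK: "E + t + 3 * ?c \<le> ?K * ?c"
  proof -
    have t: "t \<le> t * ?c" using c by simp
    then have "D \<le> (s * k + 2 + t) * ?c" unfolding D_def by (simp add: algebra_simps)
    then have "(s * k) * (s * k) * D \<le> (s * k) * (s * k) * ((s * k + 2 + t) * ?c)"
      by (rule mult_le_mono2)
    moreover have "s * k * t \<le> s * k * (t * ?c)" using t by (rule mult_le_mono2)
    ultimately have "E + t + 3 * ?c
        \<le> t * ?c + s * k * (t * ?c) + (s * k) * (s * k) * ((s * k + 2 + t) * ?c) + t * ?c + 3 * ?c"
      unfolding E_def using t by linarith
    also have "\<dots> = ?K * ?c" by (simp add: algebra_simps)
    finally show ?thesis .
  qed
  have Rfin: "finite R" and RQ: "R \<subseteq> Q" using Q(1) unfolding R_def by auto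
  show ?thesis
  proof (cases "\<exists>x\<in>V. \<forall>P\<in>R. x \<in> P")
    case True
    then obtain x where x: "x \<in> V" "\<forall>P\<in>R. x \<in> P" by blast
    \<comment> \<open>A member avoiding \<open>x\<close> contains no pair of \<open>R\<close>, as
      all of these contain \<open>x\<close>.\<close>
    have "card F \<le> card {A \<in> F. x \<in> A} + card ?Bad"
      using finF x by (intro order.trans[OF card_mono card_Un_le]) auto
    moreover have "card {A \<in> F. x \<in> A} \<le> s * ?M + t"
      using card_star_le[OF V F ui x(1) _ avoid[OF x(1)]] k by simp
    ultimately show ?thesis using bad EK by linarith
  next
    case False
    have "P \<inter> P' \<noteq> {}" if PP: "P \<in> R" "P' \<in> R" for P P'
    proof -
      have "D \<ge> 2 * ?c + s" "D \<ge> s * k * ?c + t"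
        unfolding D_def using st by (auto simp: algebra_simps)
      then have "card {A \<in> F. P \<subseteq> A} \<ge> 2 * ?c + s" "card {A \<in> F. P' \<subseteq> A} \<ge> s * k * ?c + t"
        using PP unfolding R_def by auto
      then show ?thesis
        using high_degree_pairs_meet[OF V F ui k] PP RQ Q(3) by blast
    qed
    then have "card R \<le> 3"
      using Rfin False Q(3) RQ \<open>V \<noteq> {}\<close>
      by (intro intersecting_pairs_star_or_triangle[where V = V]) blast+
    have "card {A \<in> F. P \<subseteq> A} \<le> (card V - 2) choose (k - 2)" if "P \<in> R" for P
    proof -
      have P: "P \<subseteq> V" "card P = 2" using that RQ Q(3) by auto
      have "card {A \<in> F. P \<subseteq> A} \<le> card {A \<in> nsets V k. P \<subseteq> A}"
        using V F by (intro card_mono) (auto simp: finite_imp_finite_nsets)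
      then show ?thesis using card_nsets_superset[OF V P(1), of k] P k by simp
    qed
    then have "card (\<Union>P\<in>R. {A \<in> F. P \<subseteq> A}) \<le> card R * ((card V - 2) choose (k - 2))"
      using Rfin by (rule card_UN_le_mult[rotated])
    also have "\<dots> \<le> 3 * ((card V - 2) choose (k - 2))" using \<open>card R \<le> 3\<close> by (rule mult_le_mono1)
    also have "\<dots> \<le> ?M + 3 * ?c" using hilton_milner_bounds(1)[OF k n] .
    also have "\<dots> \<le> s * ?M + 3 * ?c" using s by simp
    finally have "card (\<Union>P\<in>R. {A \<in> F. P \<subseteq> A}) \<le> s * ?M + 3 * ?c" .
    moreover have "card F \<le> card (\<Union>P\<in>R. {A \<in> F. P \<subseteq> A}) + card ?Bad"
      using finF Rfin by (intro order.trans[OF card_mono card_Un_le]) auto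
    ultimately show ?thesis using bad EK by linarith
  qed
qed

theorem theorem4:
  fixes k s t :: nat and \<beta> :: real
  assumes "k \<ge> 3" and "t \<ge> s" and "s \<ge> 1" and "\<beta> > 0"
  shows "\<exists>N::nat. \<forall>n\<ge>N. \<forall>F. F \<subseteq> nsets {1..n} k \<and> union_intersecting s t F \<and>
           real (card F) \<ge> (s + \<beta>) * (real ((n - 1) choose (k - 1)) - real ((n - k - 1) choose (k - 1)))
           \<longrightarrow> ell F \<le> s - 1"
proof -
  define K where "K = 2 * t + s * k * t + (s * k) * (s * k) * (s * k + 2 + t) + 3"
  \<comment> \<open>Chosen so that \<open>n - 2\<close> exceeds
    \<open>K * (k - 2) / \<beta>\<close>, the bound on \<open>n - 2\<close> that the inequalities
    below force.\<close>
  define N where "N = k + 5 + nat \<lceil>K * (k - 2) / \<beta>\<rceil>"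
  have "ell F \<le> s - 1"
    if n: "n \<ge> N" and F: "F \<subseteq> nsets {1..n} k" and ui: "union_intersecting s t F"
      and card: "real (card F) \<ge> (s + \<beta>) * (real ((n - 1) choose (k - 1)) - real ((n - k - 1) choose (k - 1)))"
    for n F
  proof (rule ccontr)
    assume "\<not> ?thesis"
    then have ell: "s \<le> ell F" by simp
    have finF: "finite F" using F finite_imp_finite_nsets finite_subset finite_atLeastAtMost by metis
    define M where "M = ((n - 1) choose (k - 1)) - ((n - k - 1) choose (k - 1))"
    define c where "c = (n - 3) choose (k - 3)"
    define p where "p = (n - 2) choose (k - 2)"
    have nk: "n \<ge> k + 4" using n unfolding N_def by simp
    have c: "c \<ge> 1" using nk zero_less_binomial[of "k - 3" "n - 3"] unfolding c_def by linarith
    \<comment> \<open>Ensures that truncated subtraction in \<open>M\<close> agrees with the real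
      subtraction of the hypothesis.\<close>
    have "(n - k - 1) choose (k - 1) \<le> (n - 1) choose (k - 1)" by (intro binomial_right_mono) simp
    then have M: "real ((n - 1) choose (k - 1)) - real ((n - k - 1) choose (k - 1)) = real M"
      unfolding M_def by simp
    have "card F \<le> s * M + K * c"
      using card_le_of_avoid[OF assms(1-3) _ _ F ui] order.trans[OF ell ell_le_card_avoid[OF finF]] nk
      unfolding K_def M_def c_def by simp
    then have "real (card F) \<le> s * M + K * c" by (metis of_nat_le_iff of_nat_add of_nat_mult)
    then have "\<beta> * M \<le> K * c" using card unfolding M by (simp add: algebra_simps)
    moreover have "p \<le> M" using hilton_milner_bounds(2)[OF assms(1) nk] unfolding p_def M_def .
    then have "\<beta> * p \<le> \<beta> * M" using assms(4) by simp
    \<comment> \<open>The factor \<open>k - 2\<close> prepares for (k-2) p = (n-2) c, after which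
      \<open>c\<close> cancels.\<close>
    ultimately have "real (k - 2) * (\<beta> * p) \<le> real (k - 2) * (K * c)"
      by (intro mult_left_mono) auto
    moreover have "(k - 2) * p = (n - 2) * c"
      using hilton_milner_bounds(3)[OF assms(1) nk] unfolding p_def c_def .
    then have "real (k - 2) * real p = real (n - 2) * real c" by (metis of_nat_mult)
    then have "real (k - 2) * (\<beta> * p) = \<beta> * real (n - 2) * real c" by (metis mult.assoc mult.left_commute)
    ultimately have "\<beta> * real (n - 2) * real c \<le> (K * real (k - 2)) * real c"
      by (metis of_nat_mult mult.assoc mult.commute)
    then have "\<beta> * real (n - 2) \<le> K * real (k - 2)" using c by simp
    then have "real (n - 2) \<le> K * real (k - 2) / \<beta>" using assms(4) by (simp add: field_simps)
    moreover have "K * real (k - 2) / \<beta> \<le> real (nat \<lceil>K * real (k - 2) / \<beta>\<rceil>)" by linarith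
    moreover have "nat \<lceil>K * real (k - 2) / \<beta>\<rceil> < n - 2" using n assms(1) unfolding N_def by simp
    ultimately show False by linarith
  qed
  then show ?thesis by blast
qed

end
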